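(* Let $k \ge 2$ be an integer, and let $D$ be a strongly connected digraph. If $D$ contains no directed cycle whose length is congruent to $1$ modulo $k$, then $\chi(D) \le k$.
   Context: Digraphs are finite and contain no loops and no parallel arcs; a pair of opposite arcs $(u,v)$ and $(v,u)$ is allowed. Cycles in digraphs are simple and directed (no repeated vertices); the length of a cycle is its number of arcs, and $u \to v \to u$ is a directed cycle of length $2$ when both arcs $(u,v)$ and $(v,u)$ are present. The chromatic number $\chi(D)$ of a digraph $D$ is the chromatic number of its underlying undirected graph, i.e. the least number of colors in a coloring of the vertices such that any two vertices joined by an arc (in either direction) receive different colors. *)

theory Defs
  imports "Graph_Theory.Graph_Theory" "HOL-Number_Theory.Cong"
begin

text \<open>
  Since \<open>\<noteq>\<close> is symmetric, orientation of the arcs is irrelevant here: this is a proper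
  colouring of the underlying undirected graph with colours \<open>0, \<dots>, n - 1\<close>.
\<close>

definition proper_coloring :: "('a, 'b) pre_digraph \<Rightarrow> nat \<Rightarrow> ('a \<Rightarrow> nat) \<Rightarrow> bool" where
  "proper_coloring G n c \<longleftrightarrow>
     (\<forall>v \<in> verts G. c v < n) \<and> (\<forall>u v. u \<rightarrow>\<^bsub>G\<^esub> v \<longrightarrow> c u \<noteq> c v)"

definition chromatic_number :: "('a, 'b) pre_digraph \<Rightarrow> nat" where
  "chromatic_number G = (LEAST n. \<exists>c. proper_coloring G n c)"

text \<open>For finite loop-free digraphs the minimum is taken over a non-empty set, so it is attained.\<close>

lemma (in digraph) chromatic_number_attained:
  "\<exists>c. proper_coloring G (chromatic_number G) c"
proof -
  obtain c where c: "bij_betw c (verts G) {0..<card (verts G)}"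
    using ex_bij_betw_finite_nat[OF finite_verts] by blast
  have "c u \<noteq> c v" if "u \<rightarrow> v" for u v
    using that adj_in_verts[OF that] adj_not_same c
    by (metis bij_betw_inv_into_left)
  moreover have "c v < card (verts G)" if "v \<in> verts G" for v
    using bij_betwE[OF c] that by auto
  ultimately have "\<exists>n c. proper_coloring G n c"
    unfolding proper_coloring_def by blast
  then show ?thesis
    unfolding chromatic_number_def by (rule LeastI_ex)
qed

end

theory Submission
  imports Defs
begin

text \<open>
  The colouring is found by giving every vertex an integer height \<open>h\<close> and reading the heights
  modulo \<open>k\<close>. Call an arc from \<open>x\<close> to \<open>y\<close> tight if \<open>h y\<close> is congruent to \<open>h x + 1\<close>; along a path
  of tight arcs the length is then determined modulo \<open>k\<close> by the heights of the two ends. Fix a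
  root \<open>r\<close>. We keep three things true: \<open>h r = 0\<close>; every vertex can be reached from \<open>r\<close> by tight
  arcs; and no arc loses as much as \<open>k * m\<close> in height, for a fixed \<open>m\<close>. Distances from
  \<open>r\<close> give such heights once \<open>m\<close> is large. As every vertex has a path back to \<open>r\<close>, the third
  condition bounds all these heights from above, and this is where strong connectivity is needed.

  Suppose that the heights do not give a proper colouring, so there is an arc from \<open>u\<close> to \<open>v\<close> with
  \<open>h u\<close> and \<open>h v\<close> congruent. Think of a spanning tree of tight arcs in which \<open>v\<close> is cut off and
  hung below \<open>u\<close>, and of raising the part \<open>S\<close> below \<open>v\<close> by 1, which makes the new tree
  arc tight. The only obstacle is an arc from some \<open>y \<in> S\<close> to some \<open>w \<notin> S\<close> that already loses
  as much as it may. This largest permitted loss is \<open>k * m - 1\<close>, so the arc is tight, and \<open>w\<close>, with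
  its subtree, can be hung below \<open>y\<close> and join \<open>S\<close>. The exception is that \<open>w\<close> is an
  ancestor of \<open>u\<close>; but then the tight path from \<open>w\<close> to \<open>u\<close>, the arc to \<open>v\<close>, the tight path from
  \<open>v\<close> to \<open>y\<close> and the arc back to \<open>w\<close> form a cycle. All its arcs but the one from \<open>u\<close> to \<open>v\<close> are
  tight, so its length is congruent to 1. Hence the raise always succeeds (\<open>raise_heights\<close>),
  and heights of maximal sum give a proper colouring.

  No tree is carried along: a tree with \<open>v\<close> hung below \<open>u\<close> is replaced by the partition into
  \<open>S\<close>, reachable from \<open>v\<close> within \<open>S\<close>, and its complement, reachable from \<open>r\<close> within the complement.
  The subtree of \<open>w\<close> becomes the set of vertices that cannot be reached from \<open>r\<close> without
  passing through \<open>w\<close>.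
\<close>

section \<open>Vertices dominated by a given vertex\<close>

text \<open>
  This is dominance as in flow graphs. The root dominates every vertex: for \<open>w = r\<close>, no path from
  \<open>r\<close> avoids \<open>w\<close>.
\<close>

definition dominated :: "'a rel \<Rightarrow> 'a set \<Rightarrow> 'a \<Rightarrow> 'a \<Rightarrow> 'a set" where
  "dominated R A r w = {x \<in> A. (r, x) \<notin> rtrancl_on (A - {w}) R}"

lemma dominated_subset: "dominated R A r w \<subseteq> A"
  by (auto simp: dominated_def)

lemma self_dominated: "w \<in> A \<Longrightarrow> w \<in> dominated R A r w"
  by (auto simp: dominated_def dest: in_rtrancl_on_in_F)

text \<open>
  On a path from \<open>r\<close> to a dominated vertex, everything after the last visit to \<open>w\<close> is dominated
  too, since a way around \<open>w\<close> to a later vertex could be continued along the path.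
\<close>

lemma dominated_reachable:
  assumes "w \<in> A" "(r, x) \<in> rtrancl_on A R" "x \<in> dominated R A r w"
  shows "(w, x) \<in> rtrancl_on (dominated R A r w) R"
  using assms(2,3)
proof (induction rule: rtrancl_on_induct)
  case base
  then have "r = w"
    by (auto simp: dominated_def)
  then show ?case
    using self_dominated[OF assms(1)] by auto
next
  case (step y z)
  show ?case
  proof (cases "z = w")
    case True
    then show ?thesis
      using self_dominated[OF assms(1)] by auto
  next
    case False
    then have "y \<in> dominated R A r w"
      using step unfolding dominated_def
      by (auto intro: rtrancl_on_into_rtrancl_on)
    then show ?thesis
      using step by (meson rtrancl_on_into_rtrancl_on)
  qed
qed

lemma undominated_reachable:
  assumes "x \<in> A - dominated R A r w"
  shows "(r, x) \<in> rtrancl_on (A - dominated R A r w) R"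
proof -
  have "(r, x) \<in> rtrancl_on (A - {w}) R"
    using assms by (auto simp: dominated_def)
  then show ?thesis
  proof (induction rule: rtrancl_on_induct)
    case base
    then show ?case
      by (auto simp: dominated_def)
  next
    case (step y z)
    then have "(r, z) \<in> rtrancl_on (A - {w}) R"
      by (meson rtrancl_on_into_rtrancl_on)
    then have "z \<in> A - dominated R A r w"
      using step by (auto simp: dominated_def)
    then show ?case
      using step by (meson rtrancl_on_into_rtrancl_on)
  qed
qed

lemma rtrancl_on_mono_dom:
  assumes "(a, b) \<in> rtrancl_on A R" "A \<subseteq> B"
    and "\<And>x y. (x, y) \<in> R \<Longrightarrow> x \<in> A \<Longrightarrow> y \<in> A \<Longrightarrow> (x, y) \<in> R'"
  shows "(a, b) \<in> rtrancl_on B R'"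
  using assms(1)
proof (induction rule: rtrancl_on_induct)
  case base
  then show ?case
    using assms(2) by auto
next
  case (step y z)
  then show ?case
    using assms(2,3) by (meson rtrancl_on_into_rtrancl_on subsetD)
qed

section \<open>Tight arcs and cycles\<close>

definition tight :: "('a, 'b) pre_digraph \<Rightarrow> nat \<Rightarrow> ('a \<Rightarrow> int) \<Rightarrow> 'a rel" where
  "tight G k h = {(x, y). x \<rightarrow>\<^bsub>G\<^esub> y \<and> [h y = h x + 1] (mod int k)}"

context wf_digraph
begin

lemma awalk_cong_length:
  assumes "awalk x p y"
    and "\<And>e. e \<in> set p \<Longrightarrow> [h (head G e) = h (tail G e) + 1] (mod int k)"
  shows "[h y = h x + int (length p)] (mod int k)"
  using assms
proof (induction p arbitrary: x)
  case Nil
  then show ?case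
    by (simp add: awalk_Nil_iff)
next
  case (Cons e p)
  then have "[h y = h (head G e) + int (length p)] (mod int k)"
    by (simp add: awalk_Cons_iff)
  moreover have "[h (head G e) + int (length p) = h x + 1 + int (length p)] (mod int k)"
    using Cons.prems by (intro cong_add) (auto simp: awalk_Cons_iff)
  ultimately show ?case
    using cong_trans by (fastforce simp: algebra_simps)
qed

text \<open>
  Cutting closed parts out of a walk leaves only arcs of the walk, so the resulting path is still
  tight and stays in \<open>A\<close>; the set \<open>A\<close> is what later keeps two such paths disjoint.
\<close>

lemma tight_apath:
  assumes "(x, y) \<in> rtrancl_on A (tight G k h)" "A \<subseteq> verts G"
  obtains p where "apath x p y" "set (awalk_verts x p) \<subseteq> A"
    "[h y = h x + int (length p)] (mod int k)"
proof -
  let ?T = "{e \<in> arcs G. tail G e \<in> A \<and> head G e \<in> A \<and>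
    [h (head G e) = h (tail G e) + 1] (mod int k)}"
  have "\<exists>p. awalk x p y \<and> set p \<subseteq> ?T"
    using assms(1)
  proof (induction rule: rtrancl_on_induct)
    case base
    then show ?case
      using assms(2) by (intro exI[of _ "[]"]) (auto simp: awalk_Nil_iff)
  next
    case (step y z)
    then obtain p where p: "awalk x p y" "set p \<subseteq> ?T"
      by blast
    obtain e where e: "e \<in> arcs G" "tail G e = y" "head G e = z"
      using step(2) by (auto simp: tight_def)
    have "awalk y [e] z"
      using arc_implies_awalk[OF e(1)] e by simp
    then have "awalk x (p @ [e]) z"
      by (rule awalk_appendI[OF p(1)])
    moreover have "set (p @ [e]) \<subseteq> ?T"
      using p(2) e step(2-4) by (auto simp: tight_def)
    ultimately show ?case
      by blast
  qed
  then obtain p where p: "awalk x p y" "set p \<subseteq> ?T"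
    by blast
  let ?q = "awalk_to_apath p"
  have q: "apath x ?q y" "set ?q \<subseteq> ?T"
    using apath_awalk_to_apath[OF p(1)] awalk_to_apath_subset[OF p(1)] p(2) by auto
  have aw: "awalk x ?q y"
    using q(1) by (rule awalkI_apath)
  have "x \<in> A"
    using in_rtrancl_on_in_F[OF assms(1)] by simp
  then have "set (awalk_verts x ?q) \<subseteq> A"
    using q(2) by (auto simp: set_awalk_verts[OF aw])
  moreover have "[h y = h x + int (length ?q)] (mod int k)"
    using q(2) by (intro awalk_cong_length[OF aw]) auto
  ultimately show thesis
    using that q(1) by blast
qed

lemma apath_join:
  assumes "apath x p y" "apath z q w" "e \<in> arcs G" "tail G e = y" "head G e = z"
    and "set (awalk_verts x p) \<inter> set (awalk_verts z q) = {}"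
  shows "apath x (p @ e # q) w"
proof -
  have aw: "awalk x p y" "awalk z q w"
    using assms by (auto intro: awalkI_apath)
  have yp: "y \<in> set (awalk_verts x p)"
    using aw(1) by (metis awlast_of_awalk awalk_verts_non_Nil awalkE last_in_set)
  have "apath y (e # q) w"
    using assms yp by (auto simp: apath_Cons_iff)
  moreover have "awlast x p = y"
    using aw(1) by (auto elim: awalkE)
  ultimately show ?thesis
    using assms by (auto simp: apath_append_iff)
qed

lemma apath_closing_arc_cycle:
  assumes "apath x p y" "e \<in> arcs G" "tail G e = y" "head G e = x"
  shows "cycle (e # p)"
  unfolding cycle_def
  using assms by (intro exI[of _ y]) (auto simp: apath_def awalk_Cons_iff)

text \<open>
  Going once around a cycle changes the height by 0 in total. Each tight arc contributes 1 modulo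
  \<open>k\<close>, and an arc between congruent heights contributes 0; a cycle with exactly one arc of the
  latter kind and otherwise tight arcs therefore has length congruent to 1. The next two lemmas
  are the two ways in which such a cycle arises.
\<close>

lemma tight_path_closing_arc_cycle:
  assumes "(v, u) \<in> rtrancl_on A (tight G k h)" "A \<subseteq> verts G" "u \<rightarrow> v"
    and "[h u = h v] (mod int k)"
  shows "\<exists>p. cycle p \<and> [length p = 1] (mod k)"
proof -
  obtain p where p: "apath v p u" "[h u = h v + int (length p)] (mod int k)"
    using tight_apath[OF assms(1,2)] by metis
  obtain e where e: "e \<in> arcs G" "tail G e = u" "head G e = v"
    using assms(3) by auto
  have "[h v + int (length p) = h v + 0] (mod int k)"
    using p(2) assms(4) by (metis add_0_right cong_sym cong_trans)
  then have "[int (length p) = 0] (mod int k)"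
    by (simp only: cong_add_lcancel)
  then have "[int (length (e # p)) = int 1] (mod int k)"
    using cong_add_lcancel[of 1 "int (length p)" 0 "int k"] by simp
  then have "[length (e # p) = 1] (mod k)"
    by (simp only: cong_int_iff)
  then show ?thesis
    using apath_closing_arc_cycle[OF p(1) e] by blast
qed

lemma two_tight_paths_cycle:
  assumes "(w, u) \<in> rtrancl_on A (tight G k h)" "(v, y) \<in> rtrancl_on S (tight G k h)"
    and "A \<subseteq> verts G" "S \<subseteq> verts G" "A \<inter> S = {}"
    and "u \<rightarrow> v" "[h u = h v] (mod int k)" "(y, w) \<in> tight G k h"
  shows "\<exists>p. cycle p \<and> [length p = 1] (mod k)"
proof -
  obtain p where p: "apath w p u" "set (awalk_verts w p) \<subseteq> A"
      "[h u = h w + int (length p)] (mod int k)"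
    using tight_apath[OF assms(1,3)] by metis
  obtain q where q: "apath v q y" "set (awalk_verts v q) \<subseteq> S"
      "[h y = h v + int (length q)] (mod int k)"
    using tight_apath[OF assms(2,4)] by metis
  obtain e where e: "e \<in> arcs G" "tail G e = u" "head G e = v"
    using assms(6) by auto
  obtain f where f: "f \<in> arcs G" "tail G f = y" "head G f = w"
    using assms(8) by (auto simp: tight_def)
  have wy: "[h w = h y + 1] (mod int k)"
    using assms(8) by (auto simp: tight_def)
  let ?c = "f # p @ e # q"
  have "apath w (p @ e # q) y"
    using p(2) q(2) assms(5) by (intro apath_join[OF p(1) q(1) e]) blast
  then have "cycle ?c"
    using f by (rule apath_closing_arc_cycle)
  moreover have "[length ?c = 1] (mod k)"
  proof -
    (* the height differences around the cycle telescope, which leaves only the lengths *)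
    have "int k dvd (h u - (h w + int (length p))) + (h y - (h v + int (length q)))
        + (h w - (h y + 1)) - (h u - h v)"
      using p(3) q(3) wy assms(7) unfolding cong_iff_dvd_diff by (meson dvd_add dvd_diff)
    also have "\<dots> = - (int (length ?c) - int 1)"
      by simp
    finally have "[int (length ?c) = int 1] (mod int k)"
      by (simp only: cong_iff_dvd_diff dvd_minus_iff)
    then show ?thesis
      by (simp only: cong_int_iff)
  qed
  ultimately show ?thesis
    by blast
qed

end

section \<open>Admissible heights\<close>

text \<open>
  The bound on the loss along an arc is a multiple of \<open>k\<close>, so that an arc whose loss is the largest
  possible, \<open>k * m - 1\<close>, is tight.
\<close>

definition admissible :: "('a, 'b) pre_digraph \<Rightarrow> nat \<Rightarrow> nat \<Rightarrow> 'a \<Rightarrow> ('a \<Rightarrow> int) \<Rightarrow> bool" where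
  "admissible G k m r h \<longleftrightarrow> h r = 0 \<and>
     (\<forall>x y. x \<rightarrow>\<^bsub>G\<^esub> y \<longrightarrow> h x < h y + int (k * m)) \<and>
     (\<forall>x \<in> verts G. (r, x) \<in> rtrancl_on (verts G) (tight G k h))"

context fin_digraph
begin

lemma admissible_exists:
  assumes "k > 0" "\<And>x. x \<in> verts G \<Longrightarrow> r \<rightarrow>\<^sup>* x" "r \<in> verts G"
  obtains m h where "admissible G k m r h"
proof -
  define d where "d x = (LEAST n. (r, x) \<in> arcs_ends G ^^ n)" for x
  have d: "(r, x) \<in> arcs_ends G ^^ d x" if "x \<in> verts G" for x
  proof -
    have "(r, x) \<in> (arcs_ends G)\<^sup>*"
      using assms(2)[OF that] by (rule reachable_rtranclI)
    then have "\<exists>n. (r, x) \<in> arcs_ends G ^^ n"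
      by (simp add: rtrancl_power)
    then show ?thesis
      unfolding d_def by (rule LeastI_ex)
  qed
  have d_le: "d x \<le> n" if "(r, x) \<in> arcs_ends G ^^ n" for x n
    unfolding d_def using that by (rule Least_le)
  let ?h = "\<lambda>x. int (d x)"
  define m where "m = Suc (\<Sum>x\<in>verts G. d x)"
  have "d x < k * m" if "x \<in> verts G" for x
  proof -
    have "d x < m"
      unfolding m_def using that member_le_sum[of x "verts G" d] by simp
    then show ?thesis
      using assms(1) by (metis less_le_trans mult.commute mult_le_mono2 nat_mult_1_right
          Suc_leI One_nat_def)
  qed
  then have slack: "?h x < ?h y + int (k * m)" if "x \<rightarrow> y" for x y
    using adj_in_verts[OF that] by (metis add_increasing of_nat_0_le_iff of_nat_less_iff
        order_less_le_trans order_refl)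
  have reach: "(r, x) \<in> rtrancl_on (verts G) (tight G k ?h)" if "x \<in> verts G" for x
    using that
  proof (induction "d x" arbitrary: x)
    case 0
    then show ?case
      using d[OF 0(2)] assms(3) by simp
  next
    case (Suc n)
    obtain y where y: "(r, y) \<in> arcs_ends G ^^ n" "y \<rightarrow> x"
      using d[OF Suc.prems] by (auto simp flip: Suc.hyps(2))
    have "Suc n \<le> Suc (d y)"
      unfolding Suc.hyps(2) using d[of y] y(2) adj_in_verts[OF y(2)] by (intro d_le) auto
    then have dy: "d y = n"
      using d_le[OF y(1)] by simp
    then have "?h x = ?h y + 1"
      using Suc.hyps(2) by simp
    then have "(y, x) \<in> tight G k ?h"
      using y(2) by (simp add: tight_def)
    then show ?case
      using Suc.hyps(1)[OF dy[symmetric]] Suc.prems adj_in_verts[OF y(2)]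
      by (meson rtrancl_on_into_rtrancl_on)
  qed
  have "?h r = 0"
    using d_le[of r 0] by simp
  then have "admissible G k m r ?h"
    unfolding admissible_def using slack reach by blast
  then show thesis
    by (rule that)
qed

text \<open>
  The bound must not depend on the heights: each step of a path back to \<open>r\<close> adds at most \<open>k * m\<close>.
\<close>

lemma admissible_bounded:
  assumes "x \<rightarrow>\<^sup>* r"
  shows "\<exists>b. \<forall>h. admissible G k m r h \<longrightarrow> h x \<le> b"
  using assms
proof (induction rule: converse_reachable_induct)
  case base
  then show ?case
    by (auto simp: admissible_def)
next
  case (step x y)
  then obtain b where b: "\<And>h. admissible G k m r h \<Longrightarrow> h y \<le> b"
    by blast
  have "h x \<le> b + int (k * m)" if "admissible G k m r h" for h
  proof -
    have "h x < h y + int (k * m)"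
      using that step(1) by (auto simp: admissible_def)
    then show ?thesis
      using b[OF that] by linarith
  qed
  then show ?case
    by blast
qed

text \<open>
  Consider a vertex set of maximal size among those that behave like a subtree below \<open>v\<close>, with
  \<open>v\<close> hung below \<open>u\<close>; the vertices dominated by \<open>v\<close> are one of them. If an arc of the largest
  permitted loss left it, towards \<open>w\<close>, then the set could be enlarged by all that \<open>w\<close> dominates
  in the complement, unless \<open>w\<close> dominates \<open>u\<close>, which would create a forbidden cycle.
\<close>

lemma closed_subtree:
  assumes adm: "admissible G k m r h"
    and uv: "u \<rightarrow> v" "[h u = h v] (mod int k)"
    and nocyc: "\<nexists>p. cycle p \<and> [length p = 1] (mod k)"
  obtains S where "S \<subseteq> verts G" "v \<in> S" "u \<notin> S"
    "\<And>x. x \<in> S \<Longrightarrow> (v, x) \<in> rtrancl_on S (tight G k h)"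
    "\<And>x. x \<in> verts G - S \<Longrightarrow> (r, x) \<in> rtrancl_on (verts G - S) (tight G k h)"
    "\<And>y w. y \<rightarrow> w \<Longrightarrow> y \<in> S \<Longrightarrow> w \<notin> S \<Longrightarrow> h y + 1 < h w + int (k * m)"
proof -
  let ?V = "verts G" and ?T = "tight G k h"
  define subtree where "subtree S \<longleftrightarrow> S \<subseteq> ?V \<and> v \<in> S \<and> u \<notin> S \<and>
    (\<forall>x\<in>S. (v, x) \<in> rtrancl_on S ?T) \<and>
    (\<forall>x\<in>?V - S. (r, x) \<in> rtrancl_on (?V - S) ?T)" for S
  have uV: "u \<in> ?V" and vV: "v \<in> ?V"
    using adj_in_verts[OF uv(1)] by auto
  have reach: "(r, x) \<in> rtrancl_on ?V ?T" if "x \<in> ?V" for x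
    using adm that by (auto simp: admissible_def)
  have "subtree (dominated ?T ?V r v)"
    unfolding subtree_def
  proof (intro conjI ballI)
    show "u \<notin> dominated ?T ?V r v"
    proof
      assume "u \<in> dominated ?T ?V r v"
      then have "(v, u) \<in> rtrancl_on (dominated ?T ?V r v) ?T"
        by (rule dominated_reachable[OF vV reach[OF uV]])
      from tight_path_closing_arc_cycle[OF this dominated_subset uv] nocyc show False
        by (rule notE[rotated])
    qed
  next
    fix x assume x: "x \<in> dominated ?T ?V r v"
    then have "x \<in> ?V"
      using dominated_subset[of ?T ?V r v] by blast
    then show "(v, x) \<in> rtrancl_on (dominated ?T ?V r v) ?T"
      using dominated_reachable[OF vV reach] x by blast
  next
    fix x assume "x \<in> ?V - dominated ?T ?V r v"
    then show "(r, x) \<in> rtrancl_on (?V - dominated ?T ?V r v) ?T"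
      by (rule undominated_reachable)
  qed (rule dominated_subset, rule self_dominated[OF vV])
  moreover have "\<forall>S. subtree S \<longrightarrow> card S < Suc (card ?V)"
    unfolding subtree_def less_Suc_eq_le by (meson card_mono finite_verts)
  ultimately obtain S where "subtree S" and max: "\<And>S'. subtree S' \<Longrightarrow> card S' \<le> card S"
    using ex_has_greatest_nat[of subtree _ card "Suc (card ?V)"] by metis
  then have S: "S \<subseteq> ?V" "v \<in> S" "u \<notin> S"
    and in_S: "\<And>x. x \<in> S \<Longrightarrow> (v, x) \<in> rtrancl_on S ?T"
    and off_S: "\<And>x. x \<in> ?V - S \<Longrightarrow> (r, x) \<in> rtrancl_on (?V - S) ?T"
    by (simp_all add: subtree_def)
  have "h y + 1 < h w + int (k * m)" if yw: "y \<rightarrow> w" and yS: "y \<in> S" and wS: "w \<notin> S" for y w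
  proof (rule ccontr)
    assume neg: "\<not> ?thesis"
    have "h y < h w + int (k * m)"
      using adm yw by (auto simp: admissible_def)
    with neg have "h w = h y + 1 - int k * int m"
      by simp
    then have yw_tight: "(y, w) \<in> ?T"
      using yw by (simp add: tight_def cong_iff_dvd_diff)
    define A where "A = ?V - S"
    have A: "A \<subseteq> ?V" "A \<inter> S = {}" and wA: "w \<in> A"
      using wS adj_in_verts[OF yw] by (auto simp: A_def)
    have rA: "(r, x) \<in> rtrancl_on A ?T" if "x \<in> A" for x
      using off_S that by (simp add: A_def)
    define W where "W = dominated ?T A r w"
    have wW: "w \<in> W" and WA: "W \<subseteq> A"
      using self_dominated[OF wA] dominated_subset[of ?T A r w] by (auto simp: W_def)
    have Wreach: "(w, x) \<in> rtrancl_on W ?T" if "x \<in> W" for x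
      using dominated_reachable[OF wA rA] that WA unfolding W_def by blast
    have "u \<notin> W"
    proof
      assume "u \<in> W"
      then have "(w, u) \<in> rtrancl_on A ?T"
        by (rule rtrancl_on_mono_dom[OF Wreach WA])
      from two_tight_paths_cycle[OF this in_S[OF yS] A(1) S(1) A(2) uv yw_tight] nocyc
      show False
        by (rule notE[rotated])
    qed
    have "subtree (S \<union> W)"
      unfolding subtree_def
    proof (intro conjI ballI)
      fix x assume x: "x \<in> S \<union> W"
      have vS: "(v, z) \<in> rtrancl_on (S \<union> W) ?T" if "z \<in> S" for z
        by (rule rtrancl_on_mono_dom[OF in_S[OF that]]) auto
      show "(v, x) \<in> rtrancl_on (S \<union> W) ?T"
      proof (cases "x \<in> S")
        case True
        then show ?thesis
          by (rule vS)
      next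
        case False
        then have "x \<in> W"
          using x by simp
        then have "(w, x) \<in> rtrancl_on (S \<union> W) ?T"
          by (rule rtrancl_on_mono_dom[OF Wreach]) auto
        moreover have "(v, w) \<in> rtrancl_on (S \<union> W) ?T"
          using wW by (intro rtrancl_on_into_rtrancl_on[OF vS[OF yS] yw_tight]) simp
        ultimately show ?thesis
          by (rule rtrancl_on_trans[rotated])
      qed
    next
      fix x assume x: "x \<in> ?V - (S \<union> W)"
      have eq: "?V - (S \<union> W) = A - W"
        by (auto simp: A_def)
      show "(r, x) \<in> rtrancl_on (?V - (S \<union> W)) ?T"
        using x unfolding eq unfolding W_def by (rule undominated_reachable)
    qed (use S \<open>u \<notin> W\<close> WA A(1) in blast)+
    then have "card (S \<union> W) \<le> card S"
      by (rule max)
    moreover have "S \<subset> S \<union> W"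
      using wW wS by blast
    moreover have "finite (S \<union> W)"
      using S WA A finite_subset[OF _ finite_verts] by blast
    ultimately show False
      using psubset_card_mono[of "S \<union> W" S] by simp
  qed
  then show thesis
    using that[OF S in_S off_S] by blast
qed

text \<open>
  Raising \<open>S\<close> by 1 preserves tightness inside \<open>S\<close> and inside its complement, and the arc from \<open>u\<close>
  to \<open>v\<close> becomes tight and links the two parts.
\<close>

lemma raise_heights:
  assumes adm: "admissible G k m r h"
    and uv: "u \<rightarrow> v" "[h u = h v] (mod int k)"
    and nocyc: "\<nexists>p. cycle p \<and> [length p = 1] (mod k)"
  obtains h' where "admissible G k m r h'" "(\<Sum>x\<in>verts G. h x) < (\<Sum>x\<in>verts G. h' x)"
proof -
  let ?V = "verts G"
  obtain S where S: "S \<subseteq> ?V" "v \<in> S" "u \<notin> S"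
    and in_S: "\<And>x. x \<in> S \<Longrightarrow> (v, x) \<in> rtrancl_on S (tight G k h)"
    and off_S: "\<And>x. x \<in> ?V - S \<Longrightarrow> (r, x) \<in> rtrancl_on (?V - S) (tight G k h)"
    and leave: "\<And>y w. y \<rightarrow> w \<Longrightarrow> y \<in> S \<Longrightarrow> w \<notin> S \<Longrightarrow> h y + 1 < h w + int (k * m)"
    using closed_subtree[OF assms] by blast
  define h' where "h' x = (if x \<in> S then h x + 1 else h x)" for x
  have u: "u \<in> ?V - S"
    using adj_in_verts[OF uv(1)] S by blast
  have slack: "h' x < h' y + int (k * m)" if "x \<rightarrow> y" for x y
  proof -
    have "h x < h y + int (k * m)"
      using adm that by (auto simp: admissible_def)
    then show ?thesis
      using leave[OF that] by (auto simp: h'_def)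
  qed
  have off_S': "(r, x) \<in> rtrancl_on ?V (tight G k h')" if "x \<in> ?V - S" for x
    using off_S[OF that] by (rule rtrancl_on_mono_dom) (auto simp: tight_def h'_def)
  have "[h v + 1 = h u + 1] (mod int k)"
    using uv(2) by (intro cong_add) (auto intro: cong_sym)
  then have "(u, v) \<in> tight G k h'"
    using uv(1) S by (simp add: tight_def h'_def)
  then have rv: "(r, v) \<in> rtrancl_on ?V (tight G k h')"
    using S by (intro rtrancl_on_into_rtrancl_on[OF off_S'[OF u]]) auto
  have in_S': "(v, x) \<in> rtrancl_on ?V (tight G k h')" if "x \<in> S" for x
  proof (rule rtrancl_on_mono_dom[OF in_S[OF that] S(1)])
    fix a b assume "(a, b) \<in> tight G k h" "a \<in> S" "b \<in> S"
    moreover from this have "[h b + 1 = h a + 1 + 1] (mod int k)"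
      by (intro cong_add) (auto simp: tight_def)
    ultimately show "(a, b) \<in> tight G k h'"
      by (simp add: tight_def h'_def)
  qed
  have "r \<notin> S"
    using in_rtrancl_on_in_F[OF off_S[OF u]] by blast
  then have "h' r = 0"
    using adm by (simp add: admissible_def h'_def)
  moreover have "(r, x) \<in> rtrancl_on ?V (tight G k h')" if "x \<in> ?V" for x
    using off_S' rtrancl_on_trans[OF rv in_S'] that by blast
  ultimately have "admissible G k m r h'"
    using slack unfolding admissible_def by blast
  moreover have "(\<Sum>x\<in>?V. h x) < (\<Sum>x\<in>?V. h' x)"
    using S by (intro sum_strict_mono_ex1) (auto simp: h'_def)
  ultimately show thesis
    by (rule that)
qed

end

theorem theorem1:
  fixes D :: "('a, 'b) pre_digraph" and k :: nat
  assumes "k \<ge> 2"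
    and "digraph D"
    and "strongly_connected D"
    and "\<not> (\<exists>p. pre_digraph.cycle D p \<and> [length p = 1] (mod k))"
  shows "chromatic_number D \<le> k"
proof -
  interpret digraph D
    by (rule assms(2))
  obtain r where r: "r \<in> verts D"
    using assms(3) by (auto simp: strongly_connected_def)
  have sc: "x \<rightarrow>\<^sup>*\<^bsub>D\<^esub> y" if "x \<in> verts D" "y \<in> verts D" for x y
    using assms(3) that by (auto simp: strongly_connected_def)
  obtain m h0 where h0: "admissible D k m r h0"
    using admissible_exists[of k r] assms(1) sc[OF r] r by auto
  have "\<forall>x\<in>verts D. \<exists>b. \<forall>h. admissible D k m r h \<longrightarrow> h x \<le> b"
    using admissible_bounded sc[OF _ r] by blast
  then obtain b where b: "\<And>x h. x \<in> verts D \<Longrightarrow> admissible D k m r h \<Longrightarrow> h x \<le> b x"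
    by metis
  (* the bounds b turn maximality of the sum of the heights into minimality of a natural number *)
  let ?gap = "\<lambda>h. nat ((\<Sum>x\<in>verts D. b x) - (\<Sum>x\<in>verts D. h x))"
  obtain h where adm: "admissible D k m r h"
    and least: "\<And>h'. admissible D k m r h' \<Longrightarrow> ?gap h \<le> ?gap h'"
    using ex_has_least_nat[of "admissible D k m r" h0 ?gap] h0 by blast
  define c where "c x = nat (h x mod int k)" for x
  have "c u \<noteq> c v" if uv: "u \<rightarrow>\<^bsub>D\<^esub> v" for u v
  proof
    assume "c u = c v"
    then have "[h u = h v] (mod int k)"
      using assms(1) by (simp add: c_def cong_def eq_nat_nat_iff)
    then obtain h' where h': "admissible D k m r h'"
        "(\<Sum>x\<in>verts D. h x) < (\<Sum>x\<in>verts D. h' x)"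
      using raise_heights[OF adm uv _ assms(4)] by blast
    have "(\<Sum>x\<in>verts D. h' x) \<le> (\<Sum>x\<in>verts D. b x)"
      using b h'(1) by (intro sum_mono) blast
    then show False
      using least[OF h'(1)] h'(2) by linarith
  qed
  moreover have "c x < k" for x
    using assms(1) by (simp add: c_def nat_less_iff)
  ultimately have "\<exists>c. proper_coloring D k c"
    by (auto simp: proper_coloring_def)
  then show ?thesis
    unfolding chromatic_number_def by (rule Least_le)
qed

end
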